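(* For $i=1,2$ let $R_i$ be a commutative ring with $1\neq0$ and let $S_i$ be a multiplicative set of $R_i$. Set $R=R_1\times R_2$ and $S=S_1\times S_2$. Then $S$ is a strongly multiplicative set of $R$ if and only if both $S_1$ and $S_2$ are strongly multiplicative (in $R_1$ and $R_2$ respectively).
   Context: A multiplicative set $S$ of a commutative ring $R$ is a subset with $0\notin S$, $1\in S$, and $st\in S$ for all $s,t\in S$. It is strongly multiplicative if $\bigl(\bigcap_{i\in\Delta}s_iR\bigr)\cap S\neq\varnothing$ for every family $(s_i)_{i\in\Delta}$ of elements of $S$. *)

theory Defs
  imports "HOL-Algebra.Chinese_Remainder"
begin

definition multiplicative_set :: "('a, 'm) ring_scheme \<Rightarrow> 'a set \<Rightarrow> bool" where
  "multiplicative_set R S \<longleftrightarrow> submonoid S R \<and> \<zero>\<^bsub>R\<^esub> \<notin> S"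

text \<open>
  The empty intersection is \<^term>\<open>UNIV\<close> rather than the carrier; since the intersection is
  cut down to \<^term>\<open>S \<subseteq> carrier R\<close>, this makes no difference.
  HOL cannot quantify over index types inside a definition, so the index sets range over sets of
  ring elements. The lemma \<open>strongly_multiplicative_set_family\<close> below shows that families over
  arbitrary index types are covered.
\<close>
definition strongly_multiplicative_set :: "('a, 'm) ring_scheme \<Rightarrow> 'a set \<Rightarrow> bool" where
  "strongly_multiplicative_set R S \<longleftrightarrow>
     multiplicative_set R S \<and>
     (\<forall>(\<Delta> :: 'a set) s. s \<in> \<Delta> \<rightarrow> S \<longrightarrow> (\<Inter>i\<in>\<Delta>. PIdl\<^bsub>R\<^esub> (s i)) \<inter> S \<noteq> {})"

lemma strongly_multiplicative_set_family:
  fixes s :: "'i \<Rightarrow> 'a" and \<Delta> :: "'i set"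
  assumes "strongly_multiplicative_set R S" and "s \<in> \<Delta> \<rightarrow> S"
  shows "(\<Inter>i\<in>\<Delta>. PIdl\<^bsub>R\<^esub> (s i)) \<inter> S \<noteq> {}"
proof -
  have "(\<lambda>x. x) \<in> s ` \<Delta> \<rightarrow> S"
    using assms(2) by auto
  then have "(\<Inter>x\<in>s ` \<Delta>. PIdl\<^bsub>R\<^esub> x) \<inter> S \<noteq> {}"
    using assms(1) unfolding strongly_multiplicative_set_def by blast
  then show ?thesis
    by simp
qed

end

theory Submission
  imports Defs
begin

text \<open>In a product ring, multiples are formed coordinatewise with independent multipliers, so
  a principal ideal is the product of the principal ideals of the coordinates
  (\<open>cgenideal_RDirProd\<close>). Hence a family of pairs has a common multiple in
  \<open>S \<times> S'\<close> exactly when its two coordinate families have common multiples in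
  \<open>S\<close> and in \<open>S'\<close>. Going up, the two common multiples are paired. Going
  down, a family in one factor is padded with the identity of the other and the common multiple is
  projected back.\<close>

lemma RDirProd_simps:
  "carrier (RDirProd R S) = carrier R \<times> carrier S"
  "(a, b) \<otimes>\<^bsub>RDirProd R S\<^esub> (c, d) = (a \<otimes>\<^bsub>R\<^esub> c, b \<otimes>\<^bsub>S\<^esub> d)"
  "\<one>\<^bsub>RDirProd R S\<^esub> = (\<one>\<^bsub>R\<^esub>, \<one>\<^bsub>S\<^esub>)"
  "\<zero>\<^bsub>RDirProd R S\<^esub> = (\<zero>\<^bsub>R\<^esub>, \<zero>\<^bsub>S\<^esub>)"
  by (simp_all add: RDirProd_def DirProd_def monoid.defs)

text \<open>The multiplier of \<open>p\<close> ranges over a full product of carriers, so its two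
  components can be chosen separately.\<close>

lemma cgenideal_RDirProd:
  "PIdl\<^bsub>RDirProd R S\<^esub> p = (PIdl\<^bsub>R\<^esub> (fst p)) \<times> (PIdl\<^bsub>S\<^esub> (snd p))"
  by (cases p) (auto simp: cgenideal_def RDirProd_simps; blast)

lemma multiplicative_set_RDirProd:
  assumes "multiplicative_set R S" and "multiplicative_set R' S'"
  shows "multiplicative_set (RDirProd R R') (S \<times> S')"
  using assms
  by (fastforce simp: multiplicative_set_def submonoid_def RDirProd_simps)

lemma multiplicative_set_one: "multiplicative_set R S \<Longrightarrow> \<one>\<^bsub>R\<^esub> \<in> S"
  by (simp add: multiplicative_set_def submonoid.one_closed)

text \<open>Each factor embeds its families into the product by padding with \<open>1\<close>.
  Multiplicativity of the other set puts this \<open>1\<close> in it; multiplicativity of the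
  factor's own set is the remaining half of the conclusion.\<close>

lemma strongly_multiplicative_set_RDirProdD:
  fixes R :: "('a, 'm) ring_scheme" and R' :: "('b, 'n) ring_scheme"
  assumes "strongly_multiplicative_set (RDirProd R R') (S \<times> S')"
    and S: "multiplicative_set R S" and S': "multiplicative_set R' S'"
  shows "strongly_multiplicative_set R S" and "strongly_multiplicative_set R' S'"
proof -
  have "(\<Inter>i\<in>\<Delta>. PIdl\<^bsub>R\<^esub> (s i)) \<inter> S \<noteq> {}" if "s \<in> \<Delta> \<rightarrow> S" for \<Delta> :: "'a set" and s
  proof -
    \<comment> \<open>The padded family is still indexed by elements of the factor, not by pairs as
      in the definition for the product ring, hence the appeal to
      \<open>strongly_multiplicative_set_family\<close>.\<close>
    have "(\<lambda>i. (s i, \<one>\<^bsub>R'\<^esub>)) \<in> \<Delta> \<rightarrow> S \<times> S'"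
      using that multiplicative_set_one[OF S'] by auto
    from strongly_multiplicative_set_family[OF assms(1) this] show ?thesis
      by (auto simp: cgenideal_RDirProd)
  qed
  with S show "strongly_multiplicative_set R S"
    by (simp add: strongly_multiplicative_set_def)
  have "(\<Inter>i\<in>\<Delta>. PIdl\<^bsub>R'\<^esub> (s i)) \<inter> S' \<noteq> {}" if "s \<in> \<Delta> \<rightarrow> S'" for \<Delta> :: "'b set" and s
  proof -
    have "(\<lambda>i. (\<one>\<^bsub>R\<^esub>, s i)) \<in> \<Delta> \<rightarrow> S \<times> S'"
      using that multiplicative_set_one[OF S] by auto
    from strongly_multiplicative_set_family[OF assms(1) this] show ?thesis
      by (auto simp: cgenideal_RDirProd)
  qed
  with S' show "strongly_multiplicative_set R' S'"
    by (simp add: strongly_multiplicative_set_def)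
qed

lemma strongly_multiplicative_set_RDirProdI:
  fixes R :: "('a, 'm) ring_scheme" and R' :: "('b, 'n) ring_scheme"
  assumes "strongly_multiplicative_set R S" and "strongly_multiplicative_set R' S'"
  shows "strongly_multiplicative_set (RDirProd R R') (S \<times> S')"
proof -
  have "(\<Inter>i\<in>\<Delta>. PIdl\<^bsub>RDirProd R R'\<^esub> (s i)) \<inter> (S \<times> S') \<noteq> {}"
    if s: "s \<in> \<Delta> \<rightarrow> S \<times> S'" for \<Delta> :: "('a \<times> 'b) set" and s
  proof -
    from s have "(\<lambda>i. fst (s i)) \<in> \<Delta> \<rightarrow> S" and "(\<lambda>i. snd (s i)) \<in> \<Delta> \<rightarrow> S'"
      by (auto simp: Pi_iff mem_Times_iff)
    \<comment> \<open>Both coordinate families keep the index set of pairs, which again calls for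
      the version with arbitrary index types. The witnesses \<open>x\<close> and \<open>y\<close>
      are chosen independently.\<close>
    with assms obtain x y where "x \<in> (\<Inter>i\<in>\<Delta>. PIdl\<^bsub>R\<^esub> (fst (s i))) \<inter> S"
      and "y \<in> (\<Inter>i\<in>\<Delta>. PIdl\<^bsub>R'\<^esub> (snd (s i))) \<inter> S'"
      using strongly_multiplicative_set_family by (metis ex_in_conv)
    then have "(x, y) \<in> (\<Inter>i\<in>\<Delta>. PIdl\<^bsub>RDirProd R R'\<^esub> (s i)) \<inter> (S \<times> S')"
      by (simp add: cgenideal_RDirProd)
    then show ?thesis
      by blast
  qed
  with assms show ?thesis
    by (simp add: strongly_multiplicative_set_def multiplicative_set_RDirProd)
qed

theorem theorem2p13:
  fixes R1 :: "('a, 'm) ring_scheme" and R2 :: "('b, 'n) ring_scheme"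
    and S1 :: "'a set" and S2 :: "'b set"
  assumes "cring R1" and "\<one>\<^bsub>R1\<^esub> \<noteq> \<zero>\<^bsub>R1\<^esub>"
    and "cring R2" and "\<one>\<^bsub>R2\<^esub> \<noteq> \<zero>\<^bsub>R2\<^esub>"
    and "multiplicative_set R1 S1" and "multiplicative_set R2 S2"
  shows "strongly_multiplicative_set (RDirProd R1 R2) (S1 \<times> S2) \<longleftrightarrow>
           strongly_multiplicative_set R1 S1 \<and> strongly_multiplicative_set R2 S2"
  using assms(5,6) strongly_multiplicative_set_RDirProdD strongly_multiplicative_set_RDirProdI
  by blast

end
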